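(* A restriction of a regular quasi-value to a subgroup is regular as well. More precisely, if $p$ is a regular quasi-value on an Abelian group $G$ and $H$ is a subgroup of $G$, then the restriction $p\restriction H$ is a regular quasi-value on $H$.
   Context: All groups are Abelian, written multiplicatively and endowed with no topology. $\mathbb{T}=\{z\in\mathbb{C}:|z|=1\}$ and $\lambda(z)=\min\{|t|: t\in\mathbb{R},\ e^{2\pi t i}=z\}$ for $z\in\mathbb{T}$. $G^{\#}$ is the group of all homomorphisms from $G$ into $\mathbb{T}$, $G^{\#\#}=(G^{\#})^{\#}$, and for $x\in G$, $\mathfrak{e}_x\in G^{\#\#}$ is given by $\mathfrak{e}_x(\chi)=\chi(x)$. A quasi-value on $G$ is a function $p\colon G\to[0,\infty]$ with $p(e_G)=0$, $p(x^{-1})=p(x)$ and $p(xy)\le p(x)+p(y)$ for all $x,y\in G$. Its dual quasi-value on $G^{\#}$ is $p^{\#}(\chi)=\sup\{\lambda(\chi(g))/p(g):\ g\in G,\ \chi(g)\neq1\}$, with conventions $\sup(\varnothing)=0$, $a/0=\infty$, $a/\infty=0$ for $a\in(0,\infty)$. Put $p^{\#\#}=(p^{\#})^{\#}$ (a quasi-value on $G^{\#\#}$). The regularisation of $p$ is the quasi-value $p_{\mathrm{reg}}(x)=p^{\#\#}(\mathfrak{e}_x)$ on $G$. The quasi-value $p$ is regular if $p=p_{\mathrm{reg}}$. *)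

theory Defs
  imports
    Complex_Main
    "HOL-Library.Extended_Nonnegative_Real"
    "HOL-Algebra.Group"
begin

definition circle_group :: "complex monoid" where
  "circle_group = \<lparr>carrier = {z. cmod z = 1}, mult = (*), one = 1\<rparr>"

text \<open>
  The paper writes a minimum instead of an infimum; lemma \<open>circle_length_attained\<close> below shows
  that the infimum is attained.
\<close>

definition circle_length :: "complex \<Rightarrow> real" where
  "circle_length z =
     Inf {\<bar>t\<bar> | t :: real. exp (2 * of_real pi * of_real t * \<i>) = z}"

text \<open>
  Characters are taken to be extensional (that is, \<open>undefined\<close> outside the carrier), so that
  equality of characters is equality on the carrier and the characters form a group.
\<close>

definition dual_group :: "('a, 'm) monoid_scheme \<Rightarrow> ('a \<Rightarrow> complex) monoid" where
  "dual_group G =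
     \<lparr>carrier = hom G circle_group \<inter> extensional (carrier G),
      mult = (\<lambda>\<chi> \<psi>. \<lambda>x\<in>carrier G. \<chi> x * \<psi> x),
      one = (\<lambda>x\<in>carrier G. 1)\<rparr>"

definition eval_char :: "('a, 'm) monoid_scheme \<Rightarrow> 'a \<Rightarrow> ('a \<Rightarrow> complex) \<Rightarrow> complex" where
  "eval_char G x = (\<lambda>\<chi>\<in>carrier (dual_group G). \<chi> x)"

definition quasi_value :: "('a, 'm) monoid_scheme \<Rightarrow> ('a \<Rightarrow> ennreal) \<Rightarrow> bool" where
  "quasi_value G p \<longleftrightarrow>
     p \<one>\<^bsub>G\<^esub> = 0 \<and>
     (\<forall>x\<in>carrier G. p (inv\<^bsub>G\<^esub> x) = p x) \<and>
     (\<forall>x\<in>carrier G. \<forall>y\<in>carrier G. p (x \<otimes>\<^bsub>G\<^esub> y) \<le> p x + p y)"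

text \<open>
  The supremum and the division are those of \<^typ>\<open>ennreal\<close>: the supremum of the empty set is
  \<open>0\<close>, and \<open>a / 0 = \<infinity>\<close>, \<open>a / \<infinity> = 0\<close> for \<open>0 < a < \<infinity>\<close> (see \<open>ennreal_conventions\<close>).
\<close>

definition dual_value ::
  "('a, 'm) monoid_scheme \<Rightarrow> ('a \<Rightarrow> ennreal) \<Rightarrow> ('a \<Rightarrow> complex) \<Rightarrow> ennreal" where
  "dual_value G p \<chi> =
     (SUP g\<in>{g \<in> carrier G. \<chi> g \<noteq> 1}. ennreal (circle_length (\<chi> g)) / p g)"

definition regularisation :: "('a, 'm) monoid_scheme \<Rightarrow> ('a \<Rightarrow> ennreal) \<Rightarrow> 'a \<Rightarrow> ennreal" where
  "regularisation G p x = dual_value (dual_group G) (dual_value G p) (eval_char G x)"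

definition regular_quasi_value :: "('a, 'm) monoid_scheme \<Rightarrow> ('a \<Rightarrow> ennreal) \<Rightarrow> bool" where
  "regular_quasi_value G p \<longleftrightarrow>
     quasi_value G p \<and> (\<forall>x\<in>carrier G. p x = regularisation G p x)"

lemma ennreal_conventions:
  fixes a :: ennreal
  assumes "0 < a" "a < \<infinity>"
  shows "a / 0 = \<infinity>" "a / \<infinity> = 0" "Sup ({} :: ennreal set) = 0"
  using assms by (simp_all add: divide_ennreal_def ennreal_mult_top bot_ennreal)

lemma circle_length_attained:
  assumes "cmod z = 1"
  obtains t :: real where "exp (2 * of_real pi * of_real t * \<i>) = z" "\<bar>t\<bar> = circle_length z"
    "\<And>s :: real. exp (2 * of_real pi * of_real s * \<i>) = z \<Longrightarrow> \<bar>t\<bar> \<le> \<bar>s\<bar>"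
proof -
  have ex: "exp (2 * of_real pi * of_real s * \<i>) = cis (2 * pi * s)" for s :: real
    by (simp add: cis_conv_exp mult_ac)
  define t0 where "t0 = Arg z / (2 * pi)"
  define t where "t = t0 - of_int (round t0)"
  have "z \<noteq> 0" using assms by auto
  then have z: "cis (2 * pi * t0) = z"
    using assms cis_Arg[of z] by (simp add: t0_def sgn_div_norm)
  have per: "cis (2 * pi * of_int n) = 1" for n :: int
    using cis_multiple_2pi[of "of_int n"] by simp
  have "2 * pi * t = 2 * pi * t0 - 2 * pi * of_int (round t0)"
    by (simp add: t_def algebra_simps)
  then have "cis (2 * pi * t) = z"
    by (simp only: cis_divide [symmetric] z per div_by_1)
  then have t: "exp (2 * of_real pi * of_real t * \<i>) = z" by (simp only: ex)
  have half: "\<bar>t\<bar> \<le> 1 / 2"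
    using of_int_round_abs_le[of t0] by (simp add: t_def abs_minus_commute)
  have min: "\<bar>t\<bar> \<le> \<bar>s\<bar>" if s: "exp (2 * of_real pi * of_real s * \<i>) = z" for s :: real
  proof -
    have "cis (2 * pi * s - 2 * pi * t) = 1"
      using s t \<open>z \<noteq> 0\<close> by (simp add: ex flip: cis_divide)
    then have "cos (2 * pi * s - 2 * pi * t) = 1" by (metis cis.simps(1) one_complex.simps(1))
    then obtain n :: int where "2 * pi * s - 2 * pi * t = of_int n * 2 * pi"
      using cos_one_2pi_int by blast
    then have "2 * pi * (s - t) = 2 * pi * of_int n" by (simp add: algebra_simps)
    then have n: "s = t + of_int n" by simp
    show ?thesis
    proof (cases "n = 0")
      case False
      then have "\<bar>real_of_int n\<bar> \<ge> 1" by linarith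
      then show ?thesis using half n by linarith
    qed (use n in simp)
  qed
  have "circle_length z = \<bar>t\<bar>"
    unfolding circle_length_def by (rule cInf_eq_minimum) (use t min in auto)
  with t min that show ?thesis by auto
qed

lemma circle_length_inverse:
  assumes "cmod z = 1"
  shows "circle_length (inverse z) = circle_length z"
proof -
  have le: "circle_length (inverse w) \<le> circle_length w" if "cmod w = 1" for w
  proof -
    obtain t where t: "exp (2 * of_real pi * of_real t * \<i>) = w" "\<bar>t\<bar> = circle_length w"
      using circle_length_attained[OF \<open>cmod w = 1\<close>] by metis
    have "cmod (inverse w) = 1" using that by (simp add: norm_inverse)
    then obtain s where s: "\<bar>s\<bar> = circle_length (inverse w)"
      "\<And>r :: real. exp (2 * of_real pi * of_real r * \<i>) = inverse w \<Longrightarrow> \<bar>s\<bar> \<le> \<bar>r\<bar>"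
      using circle_length_attained by metis
    have "exp (2 * of_real pi * of_real (- t) * \<i>) = inverse w"
      using t(1) by (simp add: exp_minus flip: t(1))
    then show ?thesis using s(2)[of "- t"] s(1) t(2) by simp
  qed
  show ?thesis
    using le[of z] le[of "inverse z"] assms by (simp add: norm_inverse)
qed

lemma circle_length_mult:
  assumes "cmod z = 1" "cmod w = 1"
  shows "circle_length (z * w) \<le> circle_length z + circle_length w"
proof -
  obtain t where t: "exp (2 * of_real pi * of_real t * \<i>) = z" "\<bar>t\<bar> = circle_length z"
    using circle_length_attained[OF assms(1)] by metis
  obtain u where u: "exp (2 * of_real pi * of_real u * \<i>) = w" "\<bar>u\<bar> = circle_length w"
    using circle_length_attained[OF assms(2)] by metis
  have "cmod (z * w) = 1" using assms by (simp add: norm_mult)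
  then obtain s where s: "\<bar>s\<bar> = circle_length (z * w)"
    "\<And>r :: real. exp (2 * of_real pi * of_real r * \<i>) = z * w \<Longrightarrow> \<bar>s\<bar> \<le> \<bar>r\<bar>"
    using circle_length_attained by metis
  have "exp (2 * of_real pi * of_real (t + u) * \<i>) = z * w"
    by (simp add: ring_distribs exp_add t(1) u(1))
  then show ?thesis using s(2)[of "t + u"] s(1) t(2) u(2) by linarith
qed

lemma circle_length_nonneg: "cmod z = 1 \<Longrightarrow> 0 \<le> circle_length z"
  by (metis abs_ge_zero circle_length_attained)

lemma dual_group_carrierD:
  assumes "\<chi> \<in> carrier (dual_group G)"
  shows "\<And>x. x \<in> carrier G \<Longrightarrow> cmod (\<chi> x) = 1"
    and "\<And>x y. x \<in> carrier G \<Longrightarrow> y \<in> carrier G \<Longrightarrow> \<chi> (x \<otimes>\<^bsub>G\<^esub> y) = \<chi> x * \<chi> y"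
    and "\<chi> \<in> extensional (carrier G)"
  using assms by (auto simp: dual_group_def circle_group_def hom_def)

lemma dual_group_inverse:
  assumes "group G" "\<chi> \<in> carrier (dual_group G)"
  shows "(\<lambda>x\<in>carrier G. inverse (\<chi> x)) \<in> carrier (dual_group G)"
    and "(\<lambda>x\<in>carrier G. inverse (\<chi> x)) \<otimes>\<^bsub>dual_group G\<^esub> \<chi> = \<one>\<^bsub>dual_group G\<^esub>"
proof -
  interpret group G by fact
  note D = dual_group_carrierD[OF assms(2)]
  show "(\<lambda>x\<in>carrier G. inverse (\<chi> x)) \<in> carrier (dual_group G)"
    using D by (auto simp: dual_group_def circle_group_def hom_def norm_inverse)
  have "\<chi> x \<noteq> 0" if "x \<in> carrier G" for x using D(1)[OF that] by auto
  then show "(\<lambda>x\<in>carrier G. inverse (\<chi> x)) \<otimes>\<^bsub>dual_group G\<^esub> \<chi> = \<one>\<^bsub>dual_group G\<^esub>"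
    by (auto simp: dual_group_def)
qed

lemma comm_group_dual_group:
  assumes "group G"
  shows "comm_group (dual_group G)"
proof -
  interpret group G by fact
  show ?thesis
  proof (rule comm_groupI)
    fix \<chi> \<psi> assume "\<chi> \<in> carrier (dual_group G)" "\<psi> \<in> carrier (dual_group G)"
    then show "\<chi> \<otimes>\<^bsub>dual_group G\<^esub> \<psi> \<in> carrier (dual_group G)"
      by (auto simp: dual_group_def circle_group_def hom_def norm_mult Pi_iff)
  next
    show "\<one>\<^bsub>dual_group G\<^esub> \<in> carrier (dual_group G)"
      by (auto simp: dual_group_def circle_group_def hom_def)
  next
    fix \<chi> assume "\<chi> \<in> carrier (dual_group G)"
    then show "\<one>\<^bsub>dual_group G\<^esub> \<otimes>\<^bsub>dual_group G\<^esub> \<chi> = \<chi>"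
      by (auto simp: dual_group_def extensional_def)
  next
    fix \<chi> assume "\<chi> \<in> carrier (dual_group G)"
    then show "\<exists>\<psi>\<in>carrier (dual_group G). \<psi> \<otimes>\<^bsub>dual_group G\<^esub> \<chi> = \<one>\<^bsub>dual_group G\<^esub>"
      using dual_group_inverse[OF assms] by blast
  qed (auto simp: dual_group_def mult_ac)
qed

lemma eval_char_in_bidual:
  assumes "group G" "x \<in> carrier G"
  shows "eval_char G x \<in> carrier (dual_group (dual_group G))"
proof -
  interpret D: comm_group "dual_group G" by (rule comm_group_dual_group) fact
  have "cmod (\<chi> x) = 1" if "\<chi> \<in> carrier (dual_group G)" for \<chi>
    using dual_group_carrierD(1)[OF that assms(2)] .
  moreover have "(\<chi> \<otimes>\<^bsub>dual_group G\<^esub> \<psi>) x = \<chi> x * \<psi> x" for \<chi> \<psi>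
    using assms(2) by (simp add: dual_group_def)
  ultimately have "eval_char G x \<in> hom (dual_group G) circle_group"
    unfolding eval_char_def by (intro homI) (auto simp: circle_group_def)
  then show ?thesis
    by (subst dual_group_def) (simp add: eval_char_def)
qed

lemma quasi_value_dual_value:
  assumes "group G"
  shows "quasi_value (dual_group G) (dual_value G p)"
proof -
  interpret D: comm_group "dual_group G" by (rule comm_group_dual_group) fact
  have one: "dual_value G p \<one>\<^bsub>dual_group G\<^esub> = 0"
  proof -
    have "{g \<in> carrier G. \<one>\<^bsub>dual_group G\<^esub> g \<noteq> 1} = {}"
      by (auto simp: dual_group_def)
    then show ?thesis by (simp only: dual_value_def image_empty Sup_empty bot_ennreal)
  qed
  have inv: "dual_value G p (inv\<^bsub>dual_group G\<^esub> \<chi>) = dual_value G p \<chi>"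
    if \<chi>: "\<chi> \<in> carrier (dual_group G)" for \<chi>
  proof -
    have eq: "inv\<^bsub>dual_group G\<^esub> \<chi> = (\<lambda>x\<in>carrier G. inverse (\<chi> x))"
      using dual_group_inverse[OF assms \<chi>] \<chi> by (metis D.inv_equality)
    show ?thesis
      unfolding dual_value_def eq
      by (rule SUP_cong) (use dual_group_carrierD(1)[OF \<chi>] in \<open>auto simp: circle_length_inverse\<close>)
  qed
  have mult: "dual_value G p (\<chi> \<otimes>\<^bsub>dual_group G\<^esub> \<psi>) \<le> dual_value G p \<chi> + dual_value G p \<psi>"
    if \<chi>: "\<chi> \<in> carrier (dual_group G)" and \<psi>: "\<psi> \<in> carrier (dual_group G)" for \<chi> \<psi>
  proof -
    have up: "ennreal (circle_length (\<phi> g)) / p g \<le> dual_value G p \<phi>"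
      if "g \<in> carrier G" "\<phi> g \<noteq> 1" for \<phi> g
      unfolding dual_value_def by (rule SUP_upper) (use that in auto)
    have "ennreal (circle_length (\<chi> g * \<psi> g)) / p g \<le> dual_value G p \<chi> + dual_value G p \<psi>"
      if g: "g \<in> carrier G" "\<chi> g * \<psi> g \<noteq> 1" for g
    proof -
      consider "\<chi> g = 1" | "\<psi> g = 1" | "\<chi> g \<noteq> 1" "\<psi> g \<noteq> 1" by blast
      then show ?thesis
      proof cases
        case 1
        then have "ennreal (circle_length (\<chi> g * \<psi> g)) / p g \<le> dual_value G p \<psi>"
          using up[of g \<psi>] g by simp
        then show ?thesis by (rule order_trans) simp
      next
        case 2
        then have "ennreal (circle_length (\<chi> g * \<psi> g)) / p g \<le> dual_value G p \<chi>"
          using up[of g \<chi>] g by simp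
        then show ?thesis by (rule order_trans) simp
      next
        case 3
        have n: "cmod (\<chi> g) = 1" "cmod (\<psi> g) = 1"
          using dual_group_carrierD(1)[OF \<chi> g(1)] dual_group_carrierD(1)[OF \<psi> g(1)] by simp_all
        then have "ennreal (circle_length (\<chi> g * \<psi> g))
            \<le> ennreal (circle_length (\<chi> g)) + ennreal (circle_length (\<psi> g))"
          by (simp add: circle_length_mult circle_length_nonneg flip: ennreal_plus)
        then have "ennreal (circle_length (\<chi> g * \<psi> g)) / p g
            \<le> ennreal (circle_length (\<chi> g)) / p g + ennreal (circle_length (\<psi> g)) / p g"
          by (simp add: divide_right_mono_ennreal flip: add_divide_distrib_ennreal)
        also have "\<dots> \<le> dual_value G p \<chi> + dual_value G p \<psi>"
          using up[of g \<chi>] up[of g \<psi>] g 3 by (intro add_mono) auto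
        finally show ?thesis .
      qed
    qed
    then show ?thesis
      unfolding dual_value_def[of G p "\<chi> \<otimes>\<^bsub>dual_group G\<^esub> \<psi>"]
      by (intro SUP_least) (auto simp: dual_group_def)
  qed
  show ?thesis unfolding quasi_value_def using one inv mult by blast
qed

end

theory Submission
  imports Defs
begin

text \<open>
  The regularisation never exceeds the original function, so only the inequality
  \<open>p x \<le> (p \<restriction> H)\<^sub>r\<^sub>e\<^sub>g x\<close> for \<open>x \<in> H\<close> is at stake. Since \<open>p\<close> is regular, \<open>p x\<close> is the supremum
  of the quotients of the length of \<open>\<chi> x\<close> by the dual value of \<open>\<chi>\<close>, taken over the characters
  \<open>\<chi>\<close> of \<open>G\<close> with \<open>\<chi> x \<noteq> 1\<close>. Restricting such a \<open>\<chi>\<close> to \<open>H\<close> leaves the numerator unchanged and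
  can only decrease the denominator, which becomes a supremum over fewer group elements. Each
  quotient is thus dominated by one that enters the regularisation of \<open>p \<restriction> H\<close>, which is the content
  of \<open>regularisation_le_subgroup\<close>.
\<close>

lemma regularisation_eq_SUP:
  assumes "x \<in> carrier G"
  shows "regularisation G p x =
    (SUP \<chi>\<in>{\<chi> \<in> carrier (dual_group G). \<chi> x \<noteq> 1}.
       ennreal (circle_length (\<chi> x)) / dual_value G p \<chi>)"
  unfolding regularisation_def dual_value_def[of "dual_group G"]
  by (rule SUP_cong) (auto simp: eval_char_def)

lemma dual_value_upper:
  assumes "x \<in> carrier G" "\<chi> x \<noteq> 1"
  shows "ennreal (circle_length (\<chi> x)) / p x \<le> dual_value G p \<chi>"
  unfolding dual_value_def by (rule SUP_upper) (use assms in auto)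

text \<open>
  The exchange survives denominators equal to \<open>0\<close> or \<open>\<infinity>\<close> because \<^typ>\<open>ennreal\<close> has
  \<open>a / \<infinity> = 0\<close> for every \<open>a\<close> and \<open>a / 0 = \<infinity>\<close> for every \<open>a \<noteq> 0\<close>.
\<close>

lemma ennreal_divide_le_swap:
  fixes a b c :: ennreal
  assumes "a / b \<le> c"
  shows "a / c \<le> b"
proof (cases "a = 0 \<or> b = \<infinity> \<or> c = \<infinity>")
  case True
  then show ?thesis by auto
next
  case False
  then have "b \<noteq> 0" using assms by (auto simp: top_unique)
  have "a = a / b * b"
    using False \<open>b \<noteq> 0\<close> by (simp add: ennreal_divide_times top.not_eq_extremum)
  also have "\<dots> \<le> c * b" using assms by (rule mult_right_mono) simp
  finally have le: "a \<le> c * b" .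
  have "c \<noteq> 0" using le False by (cases "c = 0") simp_all
  then have "0 < c" by (simp add: zero_less_iff_neq_zero)
  then show ?thesis using le by (rule divide_le_posI_ennreal)
qed

lemma ennreal_divide_left_antimono:
  fixes a b c :: ennreal
  assumes "b \<le> c"
  shows "a / c \<le> a / b"
proof -
  have "inverse c \<le> inverse b"
    using assms including ennreal.lifting by transfer (rule ereal_inverse_antimono)
  then show ?thesis unfolding divide_ennreal_def by (rule mult_left_mono) simp
qed

text \<open>
  This is the analogue of the canonical map into a bidual not increasing the norm: by definition
  the dual value of \<open>\<chi>\<close> bounds the length of \<open>\<chi> x\<close> relative to \<open>p x\<close>, and swapping the two
  denominators gives the bound on each quotient in the supremum.
\<close>

lemma regularisation_le:
  assumes "x \<in> carrier G"
  shows "regularisation G p x \<le> p x"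
  unfolding regularisation_eq_SUP[OF assms]
proof (rule SUP_least)
  fix \<chi> assume "\<chi> \<in> {\<chi> \<in> carrier (dual_group G). \<chi> x \<noteq> 1}"
  then have "\<chi> x \<noteq> 1" by auto
  then show "ennreal (circle_length (\<chi> x)) / dual_value G p \<chi> \<le> p x"
    by (rule ennreal_divide_le_swap[OF dual_value_upper[where \<chi> = \<chi>, OF assms]])
qed

lemma restrict_in_dual_subgroup:
  assumes "subgroup H G" "\<chi> \<in> carrier (dual_group G)"
  shows "restrict \<chi> H \<in> carrier (dual_group (G\<lparr>carrier := H\<rparr>))"
  using dual_group_carrierD[OF assms(2)] subgroup.subset[OF assms(1)]
    subgroup.m_closed[OF assms(1)]
  by (auto simp: dual_group_def circle_group_def hom_def subset_iff)

lemma dual_value_restrict_le: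
  assumes "H \<subseteq> carrier G"
  shows "dual_value (G\<lparr>carrier := H\<rparr>) (restrict p H) (restrict \<chi> H) \<le> dual_value G p \<chi>"
  unfolding dual_value_def[of "G\<lparr>carrier := H\<rparr>"]
  using assms by (intro SUP_least) (auto intro: dual_value_upper)

lemma regularisation_le_subgroup:
  assumes "subgroup H G" "x \<in> H"
  shows "regularisation G p x \<le> regularisation (G\<lparr>carrier := H\<rparr>) (restrict p H) x"
proof -
  let ?K = "G\<lparr>carrier := H\<rparr>"
  have sub: "H \<subseteq> carrier G" by (rule subgroup.subset) fact
  have xG: "x \<in> carrier G" and xK: "x \<in> carrier ?K" using sub assms(2) by auto
  show ?thesis
    unfolding regularisation_eq_SUP[OF xG] regularisation_eq_SUP[OF xK]
  proof (rule SUP_mono)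
    fix \<chi> assume "\<chi> \<in> {\<chi> \<in> carrier (dual_group G). \<chi> x \<noteq> 1}"
    then have "restrict \<chi> H \<in> {\<chi> \<in> carrier (dual_group ?K). \<chi> x \<noteq> 1}"
      using restrict_in_dual_subgroup[OF assms(1)] assms(2) by auto
    moreover have "ennreal (circle_length (\<chi> x)) / dual_value G p \<chi>
        \<le> ennreal (circle_length (restrict \<chi> H x)) /
           dual_value ?K (restrict p H) (restrict \<chi> H)"
      unfolding restrict_apply'[OF assms(2)]
      by (rule ennreal_divide_left_antimono) (rule dual_value_restrict_le[OF sub])
    ultimately show "\<exists>\<psi>\<in>{\<chi> \<in> carrier (dual_group ?K). \<chi> x \<noteq> 1}.
        ennreal (circle_length (\<chi> x)) / dual_value G p \<chi>
          \<le> ennreal (circle_length (\<psi> x)) / dual_value ?K (restrict p H) \<psi>"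
      by blast
  qed
qed

lemma quasi_value_subgroup:
  assumes "group G" "subgroup H G" "quasi_value G p"
  shows "quasi_value (G\<lparr>carrier := H\<rparr>) (restrict p H)"
proof -
  interpret group G by fact
  interpret H: subgroup H G by fact
  have "inv\<^bsub>G\<lparr>carrier := H\<rparr>\<^esub> x = inv\<^bsub>G\<^esub> x" if "x \<in> H" for x
    using m_inv_consistent[OF assms(2) that] .
  then show ?thesis
    using assms(3) by (simp add: quasi_value_def)
qed

theorem theorem5p7:
  fixes G :: "('a, 'm) monoid_scheme"
    and H :: "'a set"
    and p :: "'a \<Rightarrow> ennreal"
  assumes "comm_group G"
    and "subgroup H G"
    and "regular_quasi_value G p"
  shows "regular_quasi_value (G\<lparr>carrier := H\<rparr>) (restrict p H)"
proof -
  let ?K = "G\<lparr>carrier := H\<rparr>"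
  interpret comm_group G by fact
  have qv: "quasi_value ?K (restrict p H)"
    using quasi_value_subgroup assms(2,3) is_group by (auto simp: regular_quasi_value_def)
  have "restrict p H x = regularisation ?K (restrict p H) x" if x: "x \<in> H" for x
  proof (rule antisym)
    have "x \<in> carrier G" using x subgroup.subset[OF assms(2)] by auto
    then have "restrict p H x = regularisation G p x"
      using assms(3) x by (simp add: regular_quasi_value_def)
    also have "\<dots> \<le> regularisation ?K (restrict p H) x"
      by (rule regularisation_le_subgroup[OF assms(2) x])
    finally show "restrict p H x \<le> regularisation ?K (restrict p H) x" .
    show "regularisation ?K (restrict p H) x \<le> restrict p H x"
      by (rule regularisation_le) (use x in simp)
  qed
  with qv show ?thesis by (simp add: regular_quasi_value_def)
qed

end
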